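(* There exists a universal constant $c>0$ such that for every integer $n\ge 2$, with $\mathcal{Q}=\{[i,j]: i\le j\in[n]\}$, $$\frac{cn}{\log n}\le \mathrm{val}_{\mathcal{Q}}\le n.$$
   Context: Logarithms are base 2. $[n]=\{1,\dots,n\}$, $[i,j]=\{m\in[n]: i\le m\le j\}$, $\bar S=[n]\setminus S$. A function $f:\{-1,1\}^n\to\mathbb{R}$ is odd if $f(-x)=-f(x)$ for all $x$; $\|f\|_\infty=\max_x|f(x)|$. For $S\subseteq[n]$ and $b\in\{-1,1\}^{\bar S}$, $f_{S|b}:\{-1,1\}^S\to\mathbb{R}$ is the restriction of $f$ obtained by fixing the coordinates in $\bar S$ to $b$. $\mathrm{Var}(g)$ is the variance of $g(\mathbf{x})$ for $\mathbf{x}$ uniform on the domain of $g$. For $\mathcal{Q}\subseteq 2^{[n]}$, $$\mathrm{val}_{\mathcal{Q}} := \max_{\substack{f : \{-1,1\}^n \to \mathbb{R}\\ f \text{ odd},\ f\not\equiv 0}} \frac{\|f\|_\infty}{\max\limits_{S \in \mathcal{Q},\ b \in \{-1,1\}^{\bar{S}}}\sqrt{\mathrm{Var}(f_{S|b})}}.$$ *)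

theory Defs
  imports "HOL-Probability.Probability"
begin

text \<open>
  \<open>{-1,1}\<^sup>S\<close> consists of extensional functions (\<open>undefined\<close> outside \<open>S\<close>). A function
  \<open>{-1,1}\<^sup>S \<rightarrow> \<real>\<close> is a HOL function of which only the values on \<open>cube S\<close> are used.
\<close>

definition cube :: "nat set \<Rightarrow> (nat \<Rightarrow> int) set" where
  "cube S = (S \<rightarrow>\<^sub>E {-1, 1})"

definition odd_fun :: "nat \<Rightarrow> ((nat \<Rightarrow> int) \<Rightarrow> real) \<Rightarrow> bool" where
  "odd_fun n f \<longleftrightarrow> (\<forall>x \<in> cube {1..n}. f (\<lambda>i\<in>{1..n}. - x i) = - f x)"

definition sup_norm :: "nat \<Rightarrow> ((nat \<Rightarrow> int) \<Rightarrow> real) \<Rightarrow> real" where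
  "sup_norm n f = Max ((\<lambda>x. \<bar>f x\<bar>) ` cube {1..n})"

definition restr :: "nat \<Rightarrow> ((nat \<Rightarrow> int) \<Rightarrow> real) \<Rightarrow> nat set \<Rightarrow> (nat \<Rightarrow> int) \<Rightarrow> (nat \<Rightarrow> int) \<Rightarrow> real" where
  "restr n f S b = (\<lambda>y. f (merge S ({1..n} - S) (y, b)))"

definition Var :: "nat set \<Rightarrow> ((nat \<Rightarrow> int) \<Rightarrow> real) \<Rightarrow> real" where
  "Var S g = measure_pmf.variance (pmf_of_set (cube S)) g"

definition max_std :: "nat \<Rightarrow> nat set set \<Rightarrow> ((nat \<Rightarrow> int) \<Rightarrow> real) \<Rightarrow> real" where
  "max_std n Q f =
     Max ((\<lambda>(S, b). sqrt (Var S (restr n f S b))) ` (SIGMA S:Q. cube ({1..n} - S)))"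

text \<open>
  The maximum is literal: \<open>GREATEST\<close> is meaningful only if it is attained, so any
  bound on \<open>val\<close> has to establish attainment. Extended reals make a quotient with vanishing
  denominator \<open>\<infinity>\<close> instead of \<open>0\<close>; this does not occur when \<open>{1..n} \<in> Q\<close>, since a nonzero
  odd function has mean zero and positive variance. \<open>Q\<close> is meant to be a nonempty family of
  subsets of \<open>{1..n}\<close>, and \<open>n \<ge> 1\<close>.
\<close>

definition val :: "nat \<Rightarrow> nat set set \<Rightarrow> ereal" where
  "val n Q = (GREATEST r. \<exists>f. odd_fun n f \<and> (\<exists>x \<in> cube {1..n}. f x \<noteq> 0) \<and>
                r = ereal (sup_norm n f) / ereal (max_std n Q f))"

definition intervals :: "nat \<Rightarrow> nat set set" where
  "intervals n = {{i..j} | i j. i \<in> {1..n} \<and> j \<in> {1..n} \<and> i \<le> j}"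

end

theory Submission
  imports Defs
begin

text \<open>
  Upper bound: if all one-coordinate restrictions have standard deviation at most \<open>M\<close>, then flipping
  one coordinate changes \<open>f\<close> by at most \<open>2 * M\<close>; flipping all of them one after another takes
  \<open>f x\<close> to \<open>- f x\<close>, so \<open>\<bar>f x\<bar> \<le> n * M\<close>. This also shows that the denominator never vanishes,
  so the maximum is attained by compactness of the odd functions of sup norm 1.

  Lower bound: cut \<open>{1..n}\<close> into blocks of length \<open>k \<approx> 2 * log 2 n\<close> and let \<open>f\<close> be the number of
  all-\<open>1\<close> blocks minus the number of all-\<open>(-1)\<close> blocks, so that \<open>f\<close> is about \<open>n / k\<close> at the
  all-\<open>1\<close> point. When an interval is randomized, at most two blocks are cut by its endpoints and
  the blocks inside it contribute with probability at most \<open>2 / 2 ^ k\<close> each, so the variance stays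
  bounded.
\<close>

section \<open>Variance on the cube\<close>

lemma finite_cube [simp]: "finite S \<Longrightarrow> finite (cube S)"
  by (simp add: cube_def finite_PiE)

lemma cube_nonempty [simp]: "cube S \<noteq> {}"
  by (simp add: cube_def PiE_eq_empty_iff)

lemma card_cube: "finite S \<Longrightarrow> card (cube S) = 2 ^ card S"
  by (simp add: cube_def card_PiE numeral_2_eq_2)

lemma merge_in_cube:
  assumes "S \<subseteq> {1..n}" "y \<in> cube S" "b \<in> cube ({1..n} - S)"
  shows "merge S ({1..n} - S) (y, b) \<in> cube {1..n}"
  using assms unfolding cube_def merge_def by (fastforce simp: PiE_iff extensional_def)

lemma expectation_cube:
  fixes g :: "(nat \<Rightarrow> int) \<Rightarrow> real"
  assumes "finite S"
  shows "measure_pmf.expectation (pmf_of_set (cube S)) g = (\<Sum>y\<in>cube S. g y) / 2 ^ card S"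
  using assms by (simp add: integral_pmf_of_set card_cube)

lemma Var_eq:
  assumes "finite S"
  shows "Var S g = (\<Sum>y\<in>cube S. (g y - (\<Sum>z\<in>cube S. g z) / 2 ^ card S)\<^sup>2) / 2 ^ card S"
  unfolding Var_def by (simp add: expectation_cube[OF assms])

text \<open>The mean minimizes the mean square deviation. Variances can thus be bounded by centring
  at any convenient \<open>c\<close>, without computing the mean.\<close>

lemma Var_le_mean_square:
  assumes "finite S"
  shows "Var S g \<le> (\<Sum>y\<in>cube S. (g y - c)\<^sup>2) / 2 ^ card S"
proof -
  define m where "m = (\<Sum>z\<in>cube S. g z) / 2 ^ card S"
  have m: "(\<Sum>z\<in>cube S. g z) = 2 ^ card S * m"
    by (simp add: m_def)
  \<comment> \<open>Pointwise, \<open>(g y - c)\<^sup>2 - (g y - m)\<^sup>2\<close> factors as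
    \<open>(m - c) * (2 * g y - m - c)\<close>; on average this is
    \<open>(m - c)\<^sup>2\<close>.\<close>
  have "(\<Sum>y\<in>cube S. (g y - c)\<^sup>2)
      = (\<Sum>y\<in>cube S. (g y - m)\<^sup>2 + 2 * (m - c) * (g y) - (m - c) * (m + c))"
    by (rule sum.cong) (auto simp: algebra_simps power2_eq_square)
  also have "\<dots> = (\<Sum>y\<in>cube S. (g y - m)\<^sup>2) + 2 * (m - c) * (\<Sum>y\<in>cube S. g y)
      - 2 ^ card S * ((m - c) * (m + c))"
    by (simp add: sum.distrib sum_subtractf sum_distrib_left card_cube[OF assms])
  also have "\<dots> = (\<Sum>y\<in>cube S. (g y - m)\<^sup>2) + 2 ^ card S * (m - c)\<^sup>2"
    unfolding m by (simp add: algebra_simps power2_eq_square)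
  finally have "(\<Sum>y\<in>cube S. (g y - m)\<^sup>2) \<le> (\<Sum>y\<in>cube S. (g y - c)\<^sup>2)"
    by simp
  then show ?thesis
    unfolding Var_eq[OF assms] m_def[symmetric] by (simp add: divide_right_mono)
qed

lemma Var_scale:
  assumes "finite S" "\<And>y. y \<in> cube S \<Longrightarrow> g y = a * h y"
  shows "Var S g = a\<^sup>2 * Var S h"
proof -
  have "(\<Sum>z\<in>cube S. g z) = a * (\<Sum>z\<in>cube S. h z)"
    by (simp add: assms(2) sum_distrib_left)
  then have "(\<Sum>y\<in>cube S. (g y - (\<Sum>z\<in>cube S. g z) / 2 ^ card S)\<^sup>2)
     = (\<Sum>y\<in>cube S. a\<^sup>2 * (h y - (\<Sum>z\<in>cube S. h z) / 2 ^ card S)\<^sup>2)"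
    by (intro sum.cong refl) (simp add: assms(2) power_mult_distrib[symmetric] right_diff_distrib)
  then show ?thesis
    unfolding Var_eq[OF assms(1)] by (simp add: sum_distrib_left)
qed

text \<open>On a two-point cube the standard deviation is half the jump; this ties the denominator
  of \<open>val\<close> to single coordinate flips.\<close>

lemma Var_singleton:
  "Var {i} g = ((g (\<lambda>j\<in>{i}. 1) - g (\<lambda>j\<in>{i}. - 1)) / 2)\<^sup>2"
proof -
  have *: "cube {i} = {\<lambda>j\<in>{i}. 1, \<lambda>j\<in>{i}. - 1}"
  proof (intro equalityI subsetI)
    fix x assume "x \<in> cube {i}"
    then have "x = (\<lambda>j\<in>{i}. x i)" "x i \<in> {-1, 1}"
      by (auto simp: cube_def PiE_iff extensional_def fun_eq_iff)
    then show "x \<in> {\<lambda>j\<in>{i}. 1, \<lambda>j\<in>{i}. - 1}"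
      by auto
  qed (auto simp: cube_def PiE_iff)
  have "(\<lambda>j\<in>{i}. (1::int)) i \<noteq> (\<lambda>j\<in>{i}. - 1) i"
    by simp
  then have "(\<lambda>j\<in>{i}. (1::int)) \<noteq> (\<lambda>j\<in>{i}. - 1)"
    by metis
  then show ?thesis
    by (subst Var_eq) (simp_all add: * field_simps power2_eq_square)
qed

section \<open>Elementary properties of the two norms\<close>

lemma abs_le_sup_norm: "x \<in> cube {1..n} \<Longrightarrow> \<bar>f x\<bar> \<le> sup_norm n f"
  unfolding sup_norm_def by (rule Max_ge) auto

lemma sup_norm_leI: "(\<And>x. x \<in> cube {1..n} \<Longrightarrow> \<bar>f x\<bar> \<le> c) \<Longrightarrow> sup_norm n f \<le> c"
  unfolding sup_norm_def by (subst Max_le_iff) auto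

lemma sup_norm_attained: "\<exists>x\<in>cube {1..n}. sup_norm n f = \<bar>f x\<bar>"
proof -
  have "sup_norm n f \<in> (\<lambda>x. \<bar>f x\<bar>) ` cube {1..n}"
    unfolding sup_norm_def by (rule Max_in) auto
  then show ?thesis
    by auto
qed

lemma finite_restrictions:
  assumes "Q \<subseteq> Pow {1..n}"
  shows "finite (SIGMA S:Q. cube ({1..n} - S))"
  using assms by (intro finite_SigmaI) (auto intro: finite_subset)

lemma restrictions_nonempty: "Q \<noteq> {} \<Longrightarrow> (SIGMA S:Q. cube ({1..n} - S)) \<noteq> {}"
  by (simp add: Sigma_empty_iff)

lemma std_le_max_std:
  assumes "Q \<subseteq> Pow {1..n}" "S \<in> Q" "b \<in> cube ({1..n} - S)"
  shows "sqrt (Var S (restr n f S b)) \<le> max_std n Q f"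
  unfolding max_std_def
  using assms finite_restrictions[OF assms(1)] by (intro Max_ge) (auto intro!: rev_image_eqI)

lemma max_std_leI:
  assumes "Q \<subseteq> Pow {1..n}" "Q \<noteq> {}"
    and "\<And>S b. S \<in> Q \<Longrightarrow> b \<in> cube ({1..n} - S) \<Longrightarrow> sqrt (Var S (restr n f S b)) \<le> c"
  shows "max_std n Q f \<le> c"
  unfolding max_std_def
  using finite_restrictions[OF assms(1)] restrictions_nonempty[OF assms(2)] assms(3)
  by (subst Max_le_iff) auto

text \<open>Agreement with \<open>a * f\<close> is asked only on the cube, because the normalized
  function used later is set to 0 elsewhere.\<close>

lemma max_std_scale_le:
  assumes "Q \<subseteq> Pow {1..n}" "Q \<noteq> {}" "\<And>x. x \<in> cube {1..n} \<Longrightarrow> g x = a * f x"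
  shows "max_std n Q g \<le> \<bar>a\<bar> * max_std n Q f"
proof (rule max_std_leI[OF assms(1,2)])
  fix S b assume S: "S \<in> Q" and b: "b \<in> cube ({1..n} - S)"
  then have "S \<subseteq> {1..n}" "finite S"
    using assms(1) by (auto intro: finite_subset)
  then have "Var S (restr n g S b) = a\<^sup>2 * Var S (restr n f S b)"
    using assms(3)[OF merge_in_cube[OF _ _ b]] by (intro Var_scale) (simp_all add: restr_def)
  then have "sqrt (Var S (restr n g S b)) = \<bar>a\<bar> * sqrt (Var S (restr n f S b))"
    by (simp add: real_sqrt_mult)
  also have "\<dots> \<le> \<bar>a\<bar> * max_std n Q f"
    using std_le_max_std[OF assms(1) S b] by (simp add: mult_left_mono)
  finally show "sqrt (Var S (restr n g S b)) \<le> \<bar>a\<bar> * max_std n Q f" .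
qed

section \<open>The upper bound\<close>

text \<open>Both points lie in the same restriction to \<open>{i}\<close>, whose jump is twice its
  standard deviation.\<close>

lemma flip_coordinate_le:
  assumes Q: "Q \<subseteq> Pow {1..n}" "{i} \<in> Q"
    and x: "x \<in> cube {1..n}" and y: "y \<in> cube {1..n}"
    and eq: "\<And>j. j \<noteq> i \<Longrightarrow> x j = y j"
  shows "\<bar>f x - f y\<bar> \<le> 2 * max_std n Q f"
proof -
  define b where "b = restrict x ({1..n} - {i})"
  define u where "u = (\<lambda>s::int. merge {i} ({1..n} - {i}) (\<lambda>j\<in>{i}. s, b))"
  have i: "i \<in> {1..n}"
    using Q by auto
  have b: "b \<in> cube ({1..n} - {i})"
    using x by (auto simp: b_def cube_def PiE_iff)
  have xu: "x = u (x i)" and yu: "y = u (y i)"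
    using x y i eq
    by (auto simp: u_def b_def merge_def fun_eq_iff cube_def PiE_iff extensional_def)
  have "x i \<in> {-1, 1}" "y i \<in> {-1, 1}"
    using x y i by (auto simp: cube_def PiE_iff)
  \<comment> \<open>The left side is 0 if \<open>x i = y i\<close>; otherwise both sides
    agree.\<close>
  then have "\<bar>f x - f y\<bar> \<le> \<bar>f (u 1) - f (u (-1))\<bar>"
    by (subst xu, subst yu) auto
  also have "\<dots> = 2 * sqrt (Var {i} (restr n f {i} b))"
    by (simp add: Var_singleton restr_def u_def)
  also have "\<dots> \<le> 2 * max_std n Q f"
    using std_le_max_std[OF Q(1,2) b] by simp
  finally show ?thesis .
qed

lemma sup_norm_le_max_std:
  assumes Q: "Q \<subseteq> Pow {1..n}" "\<And>i. i \<in> {1..n} \<Longrightarrow> {i} \<in> Q"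
    and f: "odd_fun n f"
  shows "sup_norm n f \<le> n * max_std n Q f"
proof (rule sup_norm_leI)
  fix x assume x: "x \<in> cube {1..n}"
  \<comment> \<open>A path from \<open>x\<close> to its antipode: step \<open>m\<close> to
    \<open>Suc m\<close> flips only coordinate \<open>Suc m\<close>.\<close>
  define p where "p = (\<lambda>m. \<lambda>i\<in>{1..n}. if i \<le> m then - x i else x i)"
  have p: "p m \<in> cube {1..n}" for m
    using x by (auto simp: p_def cube_def PiE_iff)
  have "\<bar>f (p m) - f (p 0)\<bar> \<le> 2 * m * max_std n Q f" if "m \<le> n" for m
    using that
  proof (induction m)
    case (Suc m)
    have "\<bar>f (p (Suc m)) - f (p m)\<bar> \<le> 2 * max_std n Q f"
      using Suc.prems Q by (intro flip_coordinate_le[where i = "Suc m"] p) (auto simp: p_def)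
    with Suc show ?case
      by (simp add: algebra_simps)
  qed simp
  from this[of n] have "\<bar>f (p n) - f (p 0)\<bar> \<le> 2 * n * max_std n Q f"
    by simp
  moreover have "p 0 = x"
    using x by (auto simp: p_def cube_def PiE_iff extensional_def fun_eq_iff)
  moreover have "p n = (\<lambda>i\<in>{1..n}. - x i)"
    by (auto simp: p_def fun_eq_iff)
  \<comment> \<open>By oddness the total change is \<open>- 2 * f x\<close>, so the factor 2
    cancels.\<close>
  ultimately show "\<bar>f x\<bar> \<le> n * max_std n Q f"
    using f x by (simp add: odd_fun_def)
qed

text \<open>Ensures that the extended-real quotient in \<open>val\<close> is an ordinary real
  quotient.\<close>

lemma max_std_pos:
  assumes "Q \<subseteq> Pow {1..n}" "\<And>i. i \<in> {1..n} \<Longrightarrow> {i} \<in> Q"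
    and "odd_fun n f" "x \<in> cube {1..n}" "f x \<noteq> 0"
  shows "max_std n Q f > 0"
proof -
  have "0 < \<bar>f x\<bar>"
    using assms(5) by simp
  also have "\<dots> \<le> n * max_std n Q f"
    using abs_le_sup_norm[OF assms(4)] sup_norm_le_max_std[OF assms(1-3)] by (rule order_trans)
  finally show ?thesis
    by (simp add: zero_less_mult_iff)
qed

section \<open>Attainment of the maximum\<close>

lemma continuous_on_Max_image:
  fixes g :: "'i \<Rightarrow> 'a::topological_space \<Rightarrow> real"
  assumes "finite I" "I \<noteq> {}" "\<And>i. i \<in> I \<Longrightarrow> continuous_on A (g i)"
  shows "continuous_on A (\<lambda>x. Max ((\<lambda>i. g i x) ` I))"
  using assms
proof (induction I rule: finite_ne_induct)
  case (insert i I)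
  have "continuous_on A (\<lambda>x. max (g i x) (Max ((\<lambda>i. g i x) ` I)))"
    by (rule continuous_on_max) (use insert in auto)
  moreover have "Max ((\<lambda>i. g i x) ` insert i I) = max (g i x) (Max ((\<lambda>i. g i x) ` I))" for x
    using insert by simp
  ultimately show ?case
    by presburger
qed simp

text \<open>Functions carry the product topology, in which evaluation at a point is a coordinate
  projection.\<close>

lemma continuous_on_apply: "continuous_on A (\<lambda>f. (f x :: 'b::topological_space))"
  using continuous_on_subset[OF continuous_on_product_coordinates subset_UNIV] .

lemma continuous_sup_norm: "continuous_on A (sup_norm n)"
proof -
  have "continuous_on A (\<lambda>f. Max ((\<lambda>x. \<bar>f x\<bar>) ` cube {1..n}))"
    by (intro continuous_on_Max_image continuous_intros continuous_on_apply) auto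
  then show ?thesis
    by (simp add: sup_norm_def[abs_def])
qed

lemma continuous_max_std:
  assumes "Q \<subseteq> Pow {1..n}" "Q \<noteq> {}"
  shows "continuous_on A (max_std n Q)"
proof -
  have "continuous_on A (\<lambda>f. Max ((\<lambda>p. case p of (S, b) \<Rightarrow> sqrt (Var S (restr n f S b)))
      ` (SIGMA S:Q. cube ({1..n} - S))))"
  proof (intro continuous_on_Max_image finite_restrictions restrictions_nonempty assms)
    fix p assume "p \<in> (SIGMA S:Q. cube ({1..n} - S))"
    then obtain S b where p: "p = (S, b)" and "S \<in> Q"
      by auto
    then have S: "finite S"
      using assms(1) by (auto intro: finite_subset)
    have "continuous_on A (\<lambda>f. sqrt (Var S (restr n f S b)))"
      unfolding Var_eq[OF S] restr_def by (intro continuous_intros continuous_on_apply) auto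
    then show "continuous_on A (\<lambda>f. case p of (S, b) \<Rightarrow> sqrt (Var S (restr n f S b)))"
      by (simp add: p)
  qed
  then show ?thesis
    by (simp add: max_std_def[abs_def])
qed

text \<open>The ambient function space is infinite-dimensional, so values off the cube are pinned to
  0. The set is then closed in a product of compact intervals and singletons, which is compact by
  Tychonoff.\<close>

lemma compact_odd_unit_sphere:
  "compact {f. (\<forall>x. x \<notin> cube {1..n} \<longrightarrow> f x = 0) \<and> odd_fun n f \<and> sup_norm n f = 1}"
    (is "compact ?K")
proof -
  define B where "B = (\<lambda>x. if x \<in> cube {1..n} then {-1..1::real} else {0})"
  have "compactin (product_topology (\<lambda>_. euclidean) UNIV) (Pi\<^sub>E UNIV B)"
    by (auto simp: compactin_PiE B_def)
  then have B: "compact (Pi\<^sub>E UNIV B)"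
    by (simp add: euclidean_product_topology)
  have 1: "closed {f :: (nat \<Rightarrow> int) \<Rightarrow> real. odd_fun n f}"
    unfolding odd_fun_def Ball_def
    by (intro closed_Collect_all closed_Collect_imp closed_Collect_eq
        continuous_intros continuous_on_apply) auto
  have 2: "closed {f. sup_norm n f = 1}"
    by (intro closed_Collect_eq continuous_sup_norm continuous_intros)
  \<comment> \<open>Sup norm 1 already forces values on the cube into \<open>{-1..1}\<close>, so
    lying in the box only says that \<open>f\<close> vanishes off the cube.\<close>
  have "f \<in> Pi\<^sub>E UNIV B \<longleftrightarrow> (\<forall>x. x \<notin> cube {1..n} \<longrightarrow> f x = 0)" if "sup_norm n f = 1" for f
  proof -
    have "f x \<in> B x \<longleftrightarrow> (x \<notin> cube {1..n} \<longrightarrow> f x = 0)" for x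
      using abs_le_sup_norm[of x n f] that by (simp add: B_def abs_le_iff)
    then show ?thesis
      by (simp add: PiE_iff)
  qed
  then have "?K = Pi\<^sub>E UNIV B \<inter> ({f. odd_fun n f} \<inter> {f. sup_norm n f = 1})"
    by blast
  then show ?thesis
    using B 1 2 by (simp only:) (intro compact_Int_closed closed_Int)
qed

lemma odd_cube:
  assumes "x \<in> cube {1..n}" shows "(\<lambda>i\<in>{1..n}. - x i) \<in> cube {1..n}"
  using assms by (auto simp: cube_def PiE_iff)

text \<open>The ratio is invariant under scaling: dividing by the sup norm moves any competitor into
  the compact set without lowering its ratio.\<close>

lemma normalize_odd_fun:
  assumes Q: "Q \<subseteq> Pow {1..n}" "Q \<noteq> {}"
    and f: "odd_fun n f" "x \<in> cube {1..n}" "f x \<noteq> 0"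
  obtains g where "\<forall>x. x \<notin> cube {1..n} \<longrightarrow> g x = 0" "odd_fun n g" "sup_norm n g = 1"
    "max_std n Q g \<le> max_std n Q f / sup_norm n f"
proof
  define s where "s = sup_norm n f"
  define g where "g = (\<lambda>x. if x \<in> cube {1..n} then 1 / s * f x else 0)"
  have s: "s > 0"
    using abs_le_sup_norm[OF f(2), of f] f(3) by (simp add: s_def)
  show "\<forall>x. x \<notin> cube {1..n} \<longrightarrow> g x = 0"
    by (simp add: g_def)
  show "odd_fun n g"
    using f(1) odd_cube by (auto simp: odd_fun_def g_def)
  show "sup_norm n g = 1"
  proof (rule antisym)
    show "sup_norm n g \<le> 1"
      using s abs_le_sup_norm[of _ n f] by (intro sup_norm_leI) (simp add: g_def s_def)
    obtain z where "z \<in> cube {1..n}" "s = \<bar>f z\<bar>"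
      using sup_norm_attained[of n f] by (auto simp: s_def)
    then show "1 \<le> sup_norm n g"
      using s abs_le_sup_norm[of z n g] by (simp add: g_def)
  qed
  have "max_std n Q g \<le> \<bar>1 / s\<bar> * max_std n Q f"
    by (rule max_std_scale_le[OF Q]) (simp add: g_def)
  then show "max_std n Q g \<le> max_std n Q f / sup_norm n f"
    using s by (simp add: s_def)
qed

text \<open>On the unit sphere the ratio is the reciprocal of \<open>max_std\<close>, so a minimizer
  of this continuous function on a compact set maximizes the ratio. This gives
  \<open>GREATEST\<close> its meaning.\<close>

lemma val_attained:
  assumes n: "n \<ge> 1" and Q: "Q \<subseteq> Pow {1..n}" "\<And>i. i \<in> {1..n} \<Longrightarrow> {i} \<in> Q"
  obtains f x where "odd_fun n f" "x \<in> cube {1..n}" "f x \<noteq> 0"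
    "val n Q = ereal (sup_norm n f / max_std n Q f)"
    "\<And>g y. odd_fun n g \<Longrightarrow> y \<in> cube {1..n} \<Longrightarrow> g y \<noteq> 0 \<Longrightarrow>
       ereal (sup_norm n g / max_std n Q g) \<le> val n Q"
proof -
  define K where
    "K = {f. (\<forall>x. x \<notin> cube {1..n} \<longrightarrow> f x = 0) \<and> odd_fun n f \<and> sup_norm n f = 1}"
  define admissible where "admissible = (\<lambda>f. odd_fun n f \<and> (\<exists>x\<in>cube {1..n}. f x \<noteq> 0))"
  have Q': "Q \<noteq> {}"
    using Q(2)[of 1] n by auto
  have admissible_K: "admissible f" if "f \<in> K" for f
    using that sup_norm_attained[of n f] unfolding K_def admissible_def
    by (metis (mono_tags, lifting) abs_zero mem_Collect_eq zero_neq_one)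
  have pos: "max_std n Q f > 0" if "admissible f" for f
    using that max_std_pos[OF Q] by (auto simp: admissible_def)
  obtain x where x: "x \<in> cube {1..n}"
    using cube_nonempty by blast
  \<comment> \<open>The first coordinate is odd and nonzero; normalizing it shows that
    \<open>K\<close> is nonempty.\<close>
  have "odd_fun n (\<lambda>x. of_int (x 1))"
    using n by (simp add: odd_fun_def)
  moreover have "real_of_int (x 1) \<noteq> 0"
  proof -
    have "x 1 \<in> {-1, 1}"
      using x n unfolding cube_def by (elim PiE_mem) simp
    then show ?thesis
      by auto
  qed
  ultimately obtain g where "g \<in> K"
    using normalize_odd_fun[OF Q(1) Q' _ x] unfolding K_def by blast
  then have "K \<noteq> {}"
    by blast
  moreover have "compact K"
    unfolding K_def by (rule compact_odd_unit_sphere)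
  ultimately obtain f where f: "f \<in> K" and min: "\<And>g. g \<in> K \<Longrightarrow> max_std n Q f \<le> max_std n Q g"
    using continuous_attains_inf[OF _ _ continuous_max_std[OF Q(1) Q']] by metis
  have best: "sup_norm n g / max_std n Q g \<le> sup_norm n f / max_std n Q f"
    if g: "admissible g" for g
  proof -
    obtain x where x: "odd_fun n g" "x \<in> cube {1..n}" "g x \<noteq> 0"
      using g by (auto simp: admissible_def)
    have s: "sup_norm n g > 0"
      using abs_le_sup_norm[OF x(2), of g] x(3) by simp
    obtain h where "h \<in> K" "max_std n Q h \<le> max_std n Q g / sup_norm n g"
      using normalize_odd_fun[OF Q(1) Q' x] unfolding K_def by blast
    then have "max_std n Q f \<le> max_std n Q g / sup_norm n g"
      using min by fastforce
    moreover have "sup_norm n f = 1"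
      using f by (simp add: K_def)
    ultimately show ?thesis
      using s pos[OF g] pos[OF admissible_K[OF f]] by (simp add: field_simps)
  qed
  have quotient: "ereal (sup_norm n g) / ereal (max_std n Q g) = ereal (sup_norm n g / max_std n Q g)"
    if "admissible g" for g
    using pos[OF that] by simp
  have val: "val n Q = ereal (sup_norm n f / max_std n Q f)"
    unfolding val_def
  proof (rule Greatest_equality)
    show "\<exists>g. odd_fun n g \<and> (\<exists>x\<in>cube {1..n}. g x \<noteq> 0) \<and>
        ereal (sup_norm n f / max_std n Q f) = ereal (sup_norm n g) / ereal (max_std n Q g)"
      using quotient[OF admissible_K[OF f]] admissible_K[OF f] unfolding admissible_def by metis
  next
    fix r assume "\<exists>g. odd_fun n g \<and> (\<exists>x\<in>cube {1..n}. g x \<noteq> 0) \<and>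
        r = ereal (sup_norm n g) / ereal (max_std n Q g)"
    then obtain g where "admissible g" "r = ereal (sup_norm n g) / ereal (max_std n Q g)"
      unfolding admissible_def by blast
    then show "r \<le> ereal (sup_norm n f / max_std n Q f)"
      using quotient best by simp
  qed
  show thesis
    using that[of f] admissible_K[OF f] val best unfolding admissible_def by auto
qed

section \<open>The lower bound\<close>

text \<open>Blocks are numbered from 0 but coordinates from 1, hence the shift by 1.\<close>

definition block :: "nat \<Rightarrow> nat \<Rightarrow> nat set" where
  "block k j = {j * k + 1..j * k + k}"

definition block_sign :: "nat \<Rightarrow> nat \<Rightarrow> (nat \<Rightarrow> int) \<Rightarrow> real" where
  "block_sign k j x = of_bool (\<forall>i\<in>block k j. x i = 1) - of_bool (\<forall>i\<in>block k j. x i = -1)"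

definition block_count :: "nat \<Rightarrow> nat \<Rightarrow> (nat \<Rightarrow> int) \<Rightarrow> real" where
  "block_count k N x = (\<Sum>j<N. block_sign k j x)"

text \<open>Each coordinate determines its block; applied to the endpoints of an interval, this
  bounds the number of cut blocks.\<close>

lemma block_index: "i \<in> block k j \<Longrightarrow> j = (i - 1) div k"
  unfolding block_def by (rule sym, rule div_nat_eqI) (auto simp: mult.commute)

lemma finite_block [simp]: "finite (block k j)"
  by (simp add: block_def)

lemma card_block [simp]: "card (block k j) = k"
  by (simp add: block_def)

lemma block_subset: "j < N \<Longrightarrow> N * k \<le> n \<Longrightarrow> block k j \<subseteq> {1..n}"
proof -
  assume "j < N" "N * k \<le> n"
  then have "Suc j * k \<le> n"
    using mult_le_mono1[of "Suc j" N k] by linarith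
  then show ?thesis
    by (auto simp: block_def)
qed

lemma abs_block_sign_le: "\<bar>block_sign k j x\<bar> \<le> 1"
  by (simp add: block_sign_def)

lemma block_sign_cong: "(\<And>i. i \<in> block k j \<Longrightarrow> x i = y i) \<Longrightarrow> block_sign k j x = block_sign k j y"
  by (simp add: block_sign_def)

lemma odd_block_count:
  assumes "N * k \<le> n" shows "odd_fun n (block_count k N)"
proof -
  have "block_sign k j (\<lambda>i\<in>{1..n}. - x i) = - block_sign k j x" if "j < N" for j x
  proof -
    have "(\<lambda>i\<in>{1..n}. - x i) i = - x i" if "i \<in> block k j" for i
      using block_subset[OF \<open>j < N\<close> assms] that by auto
    moreover have "- a = 1 \<longleftrightarrow> a = -1" for a :: int
      by linarith
    ultimately show ?thesis
      by (simp add: block_sign_def)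
  qed
  then show ?thesis
    by (simp add: odd_fun_def block_count_def sum_negf)
qed

lemma block_count_ones:
  assumes "N * k \<le> n" "k \<ge> 1" shows "block_count k N (\<lambda>i\<in>{1..n}. 1) = N"
proof -
  have "block_sign k j (\<lambda>i\<in>{1..n}. 1) = 1" if "j < N" for j
  proof -
    have "(\<lambda>i\<in>{1..n}. 1::int) i = 1" if "i \<in> block k j" for i
      using block_subset[OF \<open>j < N\<close> assms(1)] that by auto
    \<comment> \<open>A nonempty block cannot be both all 1 and all -1, so the negative indicator
      vanishes.\<close>
    moreover have "j * k + 1 \<in> block k j"
      using assms(2) by (simp add: block_def)
    ultimately show ?thesis
      by (force simp: block_sign_def)
  qed
  then show ?thesis
    by (simp add: block_count_def)
qed

section \<open>Second moments of block signs and the variance bound\<close>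

text \<open>The set is a product with one choice for each coordinate in \<open>T\<close> and two for
  every other one.\<close>

lemma card_cube_constant_on:
  assumes "finite S" "T \<subseteq> S" "a \<in> {-1, 1}"
  shows "card {y \<in> cube S. \<forall>i\<in>T. y i = a} = 2 ^ (card S - card T)"
proof -
  have "{y \<in> cube S. \<forall>i\<in>T. y i = a} = Pi\<^sub>E S (\<lambda>i. if i \<in> T then {a} else {-1, 1})"
    using assms(2,3) by (auto simp: cube_def PiE_iff extensional_def split: if_splits)
  moreover have "card (Pi\<^sub>E S (\<lambda>i. if i \<in> T then {a} else {-1, 1}))
      = (\<Prod>i\<in>S. if i \<in> T then 1 else 2)"
    by (subst card_PiE[OF assms(1)]) (intro prod.cong, auto)
  moreover have "\<dots> = 2 ^ card (S - T)"
    using assms by (subst prod.If_cases) (auto simp: Diff_eq)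
  ultimately show ?thesis
    using assms by (simp add: card_Diff_subset finite_subset)
qed

text \<open>The square is at most the sum of the two indicators, each of probability
  \<open>1 / 2 ^ k\<close>.\<close>

lemma sum_block_sign_square_le:
  assumes "finite S" "block k j \<subseteq> S"
  shows "(\<Sum>y\<in>cube S. (block_sign k j y)\<^sup>2) \<le> 2 * 2 ^ card S / 2 ^ k"
proof -
  have *: "(\<Sum>y\<in>cube S. of_bool (\<forall>i\<in>block k j. y i = a)) = (2 ^ card S / 2 ^ k :: real)"
    if "a \<in> {-1, 1}" for a
  proof -
    \<comment> \<open>Makes the truncated exponent \<open>card S - k\<close> a genuine
      difference.\<close>
    have "k \<le> card S"
      using card_mono[OF assms] by simp
    then have "real (2 ^ (card S - k)) = 2 ^ card S / 2 ^ k"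
      by (simp only: of_nat_power of_nat_numeral) (simp add: power_diff)
    then show ?thesis
      using card_cube_constant_on[OF assms that] assms(1)
      by (simp add: sum_of_bool_eq Int_def)
  qed
  have "(\<Sum>y\<in>cube S. (block_sign k j y)\<^sup>2)
     \<le> (\<Sum>y\<in>cube S. of_bool (\<forall>i\<in>block k j. y i = 1) + of_bool (\<forall>i\<in>block k j. y i = -1))"
    by (intro sum_mono) (simp add: block_sign_def)
  then show ?thesis
    by (simp add: sum.distrib *)
qed

text \<open>Blocks outside \<open>S\<close> are constant and serve as the centre. The at most two
  cut blocks contribute \<open>2 * 2\<^sup>2 = 8\<close>; the inner ones contribute
  \<open>4 * N\<^sup>2 / 2 ^ k\<close>, which is at most 4.\<close>

lemma Var_block_count_le:
  fixes k N n a c :: nat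
  defines "S \<equiv> {a..c}"
  assumes N: "N\<^sup>2 \<le> 2 ^ k" "N * k \<le> n" and S: "S \<subseteq> {1..n}"
  shows "Var S (restr n (block_count k N) S b) \<le> 12"
proof -
  define inner where "inner = {j. j < N \<and> block k j \<subseteq> S}"
  \<comment> \<open>For \<open>k = 0\<close> the empty blocks are both contained in \<open>S\<close>
    and disjoint from it; the middle conjunct keeps them out of \<open>outer\<close>.\<close>
  define outer where "outer = {j. j < N \<and> \<not> block k j \<subseteq> S \<and> block k j \<inter> S = {}}"
  define cut where "cut = {j. j < N \<and> \<not> block k j \<subseteq> S \<and> block k j \<inter> S \<noteq> {}}"
  have fin: "finite inner" "finite outer" "finite cut"
    by (auto simp: inner_def outer_def cut_def)
  define M where "M = (\<lambda>y. merge S ({1..n} - S) (y, b))"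
  define const where "const = (\<Sum>j\<in>outer. block_sign k j b)"
  have split: "block_count k N x = (\<Sum>j\<in>inner. block_sign k j x) + (\<Sum>j\<in>cut. block_sign k j x)
      + (\<Sum>j\<in>outer. block_sign k j x)" for x
  proof -
    have "{..<N} = inner \<union> cut \<union> outer"
      by (auto simp: inner_def outer_def cut_def)
    then have "block_count k N x = (\<Sum>j\<in>inner \<union> cut \<union> outer. block_sign k j x)"
      by (simp add: block_count_def)
    also have "\<dots> = (\<Sum>j\<in>inner \<union> cut. block_sign k j x) + (\<Sum>j\<in>outer. block_sign k j x)"
      using fin by (intro sum.union_disjoint) (auto simp: inner_def outer_def cut_def)
    also have "(\<Sum>j\<in>inner \<union> cut. block_sign k j x)
        = (\<Sum>j\<in>inner. block_sign k j x) + (\<Sum>j\<in>cut. block_sign k j x)"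
      using fin by (intro sum.union_disjoint) (auto simp: inner_def cut_def)
    finally show ?thesis .
  qed
  have inner: "block_sign k j (M y) = block_sign k j y" if "j \<in> inner" for j y
    using that by (intro block_sign_cong) (auto simp: M_def merge_def inner_def)
  have outer: "block_sign k j (M y) = block_sign k j b" if "j \<in> outer" for j y
    using that block_subset[OF _ N(2), of j]
    by (intro block_sign_cong) (auto simp: M_def merge_def outer_def)
  have "cut \<subseteq> {(a - 1) div k, (c - 1) div k}"
  proof
    fix j assume "j \<in> cut"
    \<comment> \<open>A block is an interval, so if it meets \<open>{a..c}\<close> and also leaves
      it, it contains an endpoint.\<close>
    then have "a \<in> block k j \<or> c \<in> block k j"
      by (auto simp: cut_def S_def block_def disjoint_iff)
    then show "j \<in> {(a - 1) div k, (c - 1) div k}"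
      using block_index by blast
  qed
  then have "card cut \<le> card {(a - 1) div k, (c - 1) div k}"
    by (intro card_mono) auto
  also have "\<dots> \<le> 2"
    by (simp add: card_insert_if)
  finally have card_cut: "card cut \<le> 2" .
  have cut: "\<bar>\<Sum>j\<in>cut. block_sign k j x\<bar> \<le> 2" for x
  proof -
    have "\<bar>\<Sum>j\<in>cut. block_sign k j x\<bar> \<le> (\<Sum>j\<in>cut. 1)"
      by (intro order_trans[OF sum_abs] sum_mono abs_block_sign_le)
    then show ?thesis
      using card_cut by simp
  qed
  have card_inner: "card inner \<le> N"
    using card_mono[of "{..<N}" inner] by (auto simp: inner_def)
  have bound: "(block_count k N (M y) - const)\<^sup>2
      \<le> 2 * N * (\<Sum>j\<in>inner. (block_sign k j y)\<^sup>2) + 8" for y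
  proof -
    define A B where "A = (\<Sum>j\<in>inner. block_sign k j y)" and "B = (\<Sum>j\<in>cut. block_sign k j (M y))"
    have "block_count k N (M y) - const = A + B"
      by (simp add: split inner outer const_def A_def B_def)
    moreover have "(A + B)\<^sup>2 \<le> 2 * A\<^sup>2 + 2 * B\<^sup>2"
      using zero_le_power2[of "A - B"] by (simp add: power2_eq_square algebra_simps)
    moreover have "B\<^sup>2 \<le> 2\<^sup>2"
      using cut[of "M y"] unfolding B_def abs_le_square_iff[symmetric] by simp
    \<comment> \<open>Cauchy-Schwarz against the constant 1 reduces the inner sum to second moments
      of single blocks, at the cost of a factor of at most \<open>N\<close>.\<close>
    moreover have "A\<^sup>2 \<le> card inner * (\<Sum>j\<in>inner. (block_sign k j y)\<^sup>2)"
      using Cauchy_Schwarz_ineq_sum[of "\<lambda>_. 1" "\<lambda>j. block_sign k j y" inner] by (simp add: A_def)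
    moreover have "card inner * (\<Sum>j\<in>inner. (block_sign k j y)\<^sup>2)
        \<le> N * (\<Sum>j\<in>inner. (block_sign k j y)\<^sup>2)"
      using card_inner by (intro mult_right_mono sum_nonneg) auto
    ultimately show ?thesis
      by simp
  qed
  have "(\<Sum>y\<in>cube S. \<Sum>j\<in>inner. (block_sign k j y)\<^sup>2)
      = (\<Sum>j\<in>inner. \<Sum>y\<in>cube S. (block_sign k j y)\<^sup>2)"
    by (rule sum.swap)
  also have "\<dots> \<le> (\<Sum>j\<in>inner. 2 * 2 ^ card S / 2 ^ k)"
    by (intro sum_mono sum_block_sign_square_le) (auto simp: inner_def S_def)
  also have "\<dots> \<le> N * (2 * 2 ^ card S / 2 ^ k)"
    using card_inner by (simp add: mult_right_mono divide_right_mono)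
  finally have inner_sum: "(\<Sum>y\<in>cube S. \<Sum>j\<in>inner. (block_sign k j y)\<^sup>2)
      \<le> N * (2 * 2 ^ card S / 2 ^ k)" .
  have "Var S (restr n (block_count k N) S b)
      \<le> (\<Sum>y\<in>cube S. (restr n (block_count k N) S b y - const)\<^sup>2) / 2 ^ card S"
    by (rule Var_le_mean_square) (simp add: S_def)
  also have "\<dots> \<le> (\<Sum>y\<in>cube S. 2 * N * (\<Sum>j\<in>inner. (block_sign k j y)\<^sup>2) + 8) / 2 ^ card S"
    using bound by (intro divide_right_mono sum_mono) (auto simp: restr_def M_def)
  also have "\<dots> = 2 * N * (\<Sum>y\<in>cube S. \<Sum>j\<in>inner. (block_sign k j y)\<^sup>2) / 2 ^ card S + 8"
    by (simp add: sum.distrib sum_distrib_left card_cube S_def add_divide_distrib)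
  also have "\<dots> \<le> 2 * N * (N * (2 * 2 ^ card S / 2 ^ k)) / 2 ^ card S + 8"
    using inner_sum by (intro add_right_mono divide_right_mono mult_left_mono) auto
  also have "\<dots> = 4 * (N\<^sup>2 / 2 ^ k) + 8"
    by (simp add: power2_eq_square)
  also have "\<dots> \<le> 12"
  proof -
    have "real (N\<^sup>2) \<le> real (2 ^ k)"
      using N(1) by (rule of_nat_mono)
    then show ?thesis
      by (simp add: field_simps)
  qed
  finally show ?thesis .
qed

section \<open>Both bounds for the family of intervals\<close>

lemma intervals_subset: "intervals n \<subseteq> Pow {1..n}"
  by (auto simp: intervals_def)

lemma singleton_in_intervals: "i \<in> {1..n} \<Longrightarrow> {i} \<in> intervals n"
  unfolding intervals_def by (auto intro!: exI[of _ i])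

lemma val_intervals_ge:
  fixes N k n :: nat
  assumes "N\<^sup>2 \<le> 2 ^ k" "N * k \<le> n" "k \<ge> 1" "N \<ge> 1"
  shows "ereal (N / 4) \<le> val n (intervals n)"
proof -
  have n: "n \<ge> 1"
    using assms(2) mult_le_mono[OF assms(4,3)] by linarith
  define f where "f = block_count k N"
  define x :: "nat \<Rightarrow> int" where "x = (\<lambda>i\<in>{1..n}. 1)"
  have odd: "odd_fun n f"
    using assms(2) unfolding f_def by (rule odd_block_count)
  have x: "x \<in> cube {1..n}"
    by (auto simp: x_def cube_def)
  have fx: "f x = N"
    using assms(2,3) unfolding f_def x_def by (rule block_count_ones)
  then have nonzero: "f x \<noteq> 0"
    using assms(4) by simp
  have std: "max_std n (intervals n) f \<le> 4"
  proof (rule max_std_leI[OF intervals_subset])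
    show "intervals n \<noteq> {}"
      using singleton_in_intervals[of 1 n] n by auto
    fix S b assume "S \<in> intervals n"
    then obtain i j where "S = {i..j}" "S \<subseteq> {1..n}"
      by (auto simp: intervals_def)
    \<comment> \<open>Rounding 12 up to 16 keeps the bound on the standard deviation an
      integer.\<close>
    then have "Var S (restr n f S b) \<le> 4\<^sup>2"
      using Var_block_count_le[OF assms(1,2), of i j b] by (simp add: f_def)
    then show "sqrt (Var S (restr n f S b)) \<le> 4"
      by (rule real_le_lsqrt[rotated]) simp
  qed
  have "N / 4 \<le> sup_norm n f / max_std n (intervals n) f"
    using std max_std_pos[OF intervals_subset singleton_in_intervals odd x nonzero]
      abs_le_sup_norm[OF x, of f] fx
    by (intro frac_le) auto
  then show ?thesis
    using val_attained[OF n intervals_subset singleton_in_intervals] odd x nonzero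
    by (metis ereal_less_eq(3) order_trans)
qed

text \<open>Attainment makes \<open>val\<close> the quotient of an actual function, to which the
  flipping bound applies.\<close>

lemma val_intervals_le:
  assumes n: "n \<ge> 1" shows "val n (intervals n) \<le> ereal n"
proof -
  obtain f x where f: "odd_fun n f" "x \<in> cube {1..n}" "f x \<noteq> 0"
    "val n (intervals n) = ereal (sup_norm n f / max_std n (intervals n) f)"
    using val_attained[OF n intervals_subset singleton_in_intervals] by metis
  then show ?thesis
    using max_std_pos[OF intervals_subset singleton_in_intervals f(1-3)]
      sup_norm_le_max_std[OF intervals_subset singleton_in_intervals f(1)]
    by (simp add: field_simps)
qed

text \<open>For \<open>k\<close> twice the rounded-up logarithm, \<open>2 ^ k\<close> is at least
  \<open>n\<^sup>2\<close> and hence at least \<open>N\<^sup>2\<close>, while \<open>n div k\<close>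
  still has order \<open>n / log 2 n\<close>.\<close>

lemma block_parameters:
  assumes n: "n \<ge> (2::nat)"
  obtains k N :: nat where "N\<^sup>2 \<le> 2 ^ k" "N * k \<le> n" "k \<ge> 1" "N \<ge> 1"
    "n / log 2 n \<le> 8 * real N"
proof
  define l where "l = nat \<lceil>log 2 n\<rceil>"
  \<comment> \<open>For small \<open>n\<close>, \<open>2 * l\<close> may exceed \<open>n\<close>;
    the minimum guarantees that at least one block fits. If \<open>k = n\<close>, then
    \<open>N = 1\<close>.\<close>
  define k where "k = min n (2 * l)"
  define N where "N = n div k"
  have log: "log 2 n \<ge> 1"
    using n by simp
  \<comment> \<open>Rounding up adds less than 1, which is at most \<open>log 2 n\<close>
    itself.\<close>
  have l: "log 2 n \<le> l" "l \<le> 2 * log 2 n" "l \<ge> 1"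
    using log unfolding l_def by linarith+
  show k: "k \<ge> 1"
    using n l by (simp add: k_def)
  show Nk: "N * k \<le> n"
    by (simp add: N_def)
  show N: "N \<ge> 1"
    using k by (simp add: N_def k_def Suc_le_eq div_greater_zero_iff)
  show "N\<^sup>2 \<le> 2 ^ k"
  proof (cases "k = n")
    case True
    then show ?thesis
      using n by (simp add: N_def)
  next
    case False
    have "real n \<le> 2 ^ l"
      using l(1) n by (simp add: log_le_iff powr_realpow)
    then have "n \<le> 2 ^ l"
      by (metis of_nat_le_iff of_nat_numeral of_nat_power)
    then have "N \<le> 2 ^ l"
      using order_trans[of N n] by (simp add: N_def)
    then have "N\<^sup>2 \<le> (2 ^ l)\<^sup>2"
      by (rule power_mono) simp
    then show ?thesis
      using False by (simp add: k_def power_mult[symmetric] mult.commute min_def split: if_splits)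
  qed
  \<comment> \<open>The remainder is below \<open>k\<close>, and \<open>N \<ge> 1\<close> absorbs it
    into a factor 2. With \<open>k \<le> 2 * l\<close> and \<open>l \<le> 2 * log 2 n\<close> this
    yields the constant 8.\<close>
  have "n < N * k + k"
    using k by (metis N_def dividend_less_div_times Suc_le_eq One_nat_def add.commute)
  also have "\<dots> \<le> 2 * N * k"
    using N mult_le_mono1[of 1 N k] by simp
  also have "\<dots> \<le> 2 * N * (2 * l)"
    by (simp add: k_def)
  finally have "real n \<le> real (2 * N * (2 * l))"
    by (intro of_nat_mono less_imp_le)
  also have "\<dots> = 4 * N * l"
    by simp
  also have "\<dots> \<le> real (4 * N) * (2 * log 2 n)"
    unfolding of_nat_mult[of "4 * N"] using l(2) by (intro mult_left_mono) simp_all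
  finally show "n / log 2 n \<le> 8 * real N"
    using log by (simp add: field_simps)
qed

theorem theorem4p4:
  "\<exists>c::real. c > 0 \<and> (\<forall>n::nat. n \<ge> 2 \<longrightarrow>
     ereal (c * real n / log 2 (real n)) \<le> val n (intervals n) \<and>
     val n (intervals n) \<le> ereal (real n))"
\<comment> \<open>The constant combines 1/8 from the block parameters with 1/4 from the bound 4 on
  the standard deviation.\<close>
proof (intro exI[of _ "1 / 32"] conjI allI impI)
  fix n :: nat assume n: "n \<ge> 2"
  obtain k N where "N\<^sup>2 \<le> 2 ^ k" "N * k \<le> n" "k \<ge> 1" "N \<ge> 1" and N: "n / log 2 n \<le> 8 * real N"
    using block_parameters[OF n] by metis
  then have "ereal (N / 4) \<le> val n (intervals n)"
    by (intro val_intervals_ge)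
  moreover have "1 / 32 * real n / log 2 n \<le> N / 4"
    using N by simp
  ultimately show "ereal (1 / 32 * real n / log 2 n) \<le> val n (intervals n)"
    by (meson ereal_less_eq(3) order_trans)
  show "val n (intervals n) \<le> ereal n"
    using n by (intro val_intervals_le) simp
qed simp

end
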